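(* Let $\mathcal{A}=(V,\Sigma,\delta)$ be a parameterized arena complete for enabled actions, $t\in V$ a target vertex, and $\mathbb{K}$ any $\mathcal{A}$-coherent set. Let $W^i$, $W_{\mathrm{Alt}}^i$ and $W_{\mathbb{K}}^i$ be the sequences defined below. Then for all $i\in\mathbb{N}$, $W^i=W_{\mathrm{Alt}}^i=W_{\mathbb{K}}^i$. Moreover, the three sequences are eventually constant (stabilize), and their limits coincide: $W^\infty=W_{\mathrm{Alt}}^\infty=W_{\mathbb{K}}^\infty$.
   Context: $\mathbb{N}_{\geq 1}$ denotes the positive integers. A parameterized arena is $\mathcal{A}=(V,\Sigma,\delta)$ with $V$ finite, $\Sigma$ finite, $\delta:V\times\Sigma\times\mathbb{N}_{\geq1}\to 2^V$; $\mathrm{En}(v)$ is the set of $a$ with $\delta(v,a,k)\neq\emptyset$ for some $k$; complete for enabled actions means $a\in\mathrm{En}(v)$ implies $\delta(v,a,k)\neq\emptyset$ for all $k$. Let $\nabla(v,a,v')=\{k\mid v'\in\delta(v,a,k)\}$, assumed to be finite unions of intervals, and for $V'\subseteq V$, $\nabla(v,a,V')=\bigcap_{v'\in V'}\nabla(v,a,v')\setminus\bigcup_{v'\notin V'}\nabla(v,a,v')$ (empty intersection is $\mathbb{N}_{\geq1}$). $\mathcal{A}$-coherent set: $\mathbb{K}\subseteq 2^{\mathbb{N}_{\geq1}}$ containing $\mathbb{N}_{\geq1}$, $\emptyset$ and every $\nabla(v,a,v')$, closed under union, intersection and set difference (e.g. $2^{\mathbb{N}_{\geq1}}$ itself). $V_E^{\mathbb{K}}=\{(u,K)\mid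 u\in V,K\in\mathbb{K}\}$ with order $(u,K)\preceq(u',K')$ iff $u=u'$ and $K\subseteq K'$. For $L\subseteq V_E^{\mathbb{K}}$: $\mathrm{Dom}(L)=\{x\in V_E^{\mathbb{K}}\mid\exists x'\in L,\ x\preceq x',\ x\neq x'\}$, $\lceil L\rceil=L\setminus\mathrm{Dom}(L)$, $\downarrow_{\mathbb{K}}L=L\cup\mathrm{Dom}(L)$, and $L\sqcup L'=\lceil L\cup L'\rceil$. Operators: $\mathrm{KPred}^{\mathbb{K}}_{v,a}(S)=\{K\in\mathbb{K}\mid\forall v'\in V:(v',K\cap\nabla(v,a,v'))\in S\}$; $\mathrm{Pred}^{\mathbb{K}}(S)=\bigcup_{v\in V}\bigcup_{a\in\mathrm{En}(v)}\{(v,K)\mid K\in\mathrm{KPred}^{\mathbb{K}}_{v,a}(S)\}$. $\mathrm{KPredAlt}_{v,a}(S)=\{\bigcup_{V'\subseteq V}(\nabla(v,a,V')\cap\bigcap_{v'\in V'}K_{v'})\mid$ for each $v'\in V$, $(v',K_{v'})\in S\}$; $\mathrm{PredAlt}(S)=\bigcup_{v\in V}\bigcup_{a\in\mathrm{En}(v)}\{(v,K)\mid K\in\mathrm{KPredAlt}_{v,a}(S)\}$. Sequences: all start from $W^0=W^0_{\mathrm{Alt}}=W^0_{\mathbb{K}}=\{(t,\mathbb{N}_{\geq1})\}\cup\{(v,\emptyset)\mid v\in V\setminus\{t\}\}$. Then $W_{\mathbb{K}}^{i+1}=W_{\mathbb{K}}^i\sqcup\mathrm{Pred}^{\mathbb{K}}(\downarrow_{\mathbb{K}}W_{\mathbb{K}}^i)$;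 $W^i$ denotes $W^i_{\mathbb{K}}$ for $\mathbb{K}=2^{\mathbb{N}_{\geq1}}$; and $W_{\mathrm{Alt}}^{i+1}=W_{\mathrm{Alt}}^i\sqcup\mathrm{PredAlt}(W_{\mathrm{Alt}}^i)$. The limit $X^\infty$ of an eventually constant sequence $(X^i)$ is its eventual value. *)

theory Defs
  imports Main
begin

definition posnat :: "nat set" where
  "posnat = {1..}"

definition interval :: "nat set \<Rightarrow> bool" where
  "interval I \<longleftrightarrow> I \<subseteq> posnat \<and> (\<forall>x\<in>I. \<forall>y\<in>I. \<forall>z. x \<le> z \<and> z \<le> y \<longrightarrow> z \<in> I)"

definition finite_union_of_intervals :: "nat set \<Rightarrow> bool" where
  "finite_union_of_intervals K \<longleftrightarrow> (\<exists>\<I>. finite \<I> \<and> (\<forall>I\<in>\<I>. interval I) \<and> K = \<Union>\<I>)"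

(* Intersection taken inside the positive integers, so the empty one is posnat. *)
definition Inter_pos :: "nat set set \<Rightarrow> nat set" where
  "Inter_pos \<C> = posnat \<inter> \<Inter>\<C>"


section \<open>Parameterized arenas\<close>

(* Only the values of trans on verts, acts and posnat are meaningful; every definition
   below is relativised to these sets. *)
record ('v, 'a) arena =
  verts :: "'v set"
  acts :: "'a set"
  trans :: "'v \<Rightarrow> 'a \<Rightarrow> nat \<Rightarrow> 'v set"

definition nabla :: "('v, 'a) arena \<Rightarrow> 'v \<Rightarrow> 'a \<Rightarrow> 'v \<Rightarrow> nat set" where
  "nabla \<A> v a v' = {k \<in> posnat. v' \<in> trans \<A> v a k}"

definition nabla_set :: "('v, 'a) arena \<Rightarrow> 'v \<Rightarrow> 'a \<Rightarrow> 'v set \<Rightarrow> nat set" where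
  "nabla_set \<A> v a V' =
     Inter_pos (nabla \<A> v a ` V') - (\<Union>v'\<in>verts \<A> - V'. nabla \<A> v a v')"

definition parameterized_arena :: "('v, 'a) arena \<Rightarrow> bool" where
  "parameterized_arena \<A> \<longleftrightarrow>
     finite (verts \<A>) \<and> finite (acts \<A>) \<and>
     (\<forall>v\<in>verts \<A>. \<forall>a\<in>acts \<A>. \<forall>k\<in>posnat. trans \<A> v a k \<subseteq> verts \<A>) \<and>
     (\<forall>v\<in>verts \<A>. \<forall>a\<in>acts \<A>. \<forall>v'\<in>verts \<A>. finite_union_of_intervals (nabla \<A> v a v'))"

definition enabled :: "('v, 'a) arena \<Rightarrow> 'v \<Rightarrow> 'a set" where
  "enabled \<A> v = {a \<in> acts \<A>. \<exists>k\<in>posnat. trans \<A> v a k \<noteq> {}}"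

definition complete_for_enabled :: "('v, 'a) arena \<Rightarrow> bool" where
  "complete_for_enabled \<A> \<longleftrightarrow>
     (\<forall>v\<in>verts \<A>. \<forall>a\<in>enabled \<A> v. \<forall>k\<in>posnat. trans \<A> v a k \<noteq> {})"

definition coherent :: "('v, 'a) arena \<Rightarrow> nat set set \<Rightarrow> bool" where
  "coherent \<A> \<K> \<longleftrightarrow>
     \<K> \<subseteq> Pow posnat \<and> posnat \<in> \<K> \<and> {} \<in> \<K> \<and>
     (\<forall>v\<in>verts \<A>. \<forall>a\<in>acts \<A>. \<forall>v'\<in>verts \<A>. nabla \<A> v a v' \<in> \<K>) \<and>
     (\<forall>K\<in>\<K>. \<forall>K'\<in>\<K>. K \<union> K' \<in> \<K> \<and> K \<inter> K' \<in> \<K> \<and> K - K' \<in> \<K>)"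

lemma coherent_Pow: "coherent \<A> (Pow posnat)"
  by (auto simp: coherent_def nabla_def)


section \<open>Extended vertices\<close>

type_synonym 'v ext = "'v \<times> nat set"

definition ext_verts :: "('v, 'a) arena \<Rightarrow> nat set set \<Rightarrow> 'v ext set" where
  "ext_verts \<A> \<K> = verts \<A> \<times> \<K>"

definition ext_le :: "'v ext \<Rightarrow> 'v ext \<Rightarrow> bool" where
  "ext_le x x' \<longleftrightarrow> fst x = fst x' \<and> snd x \<subseteq> snd x'"

definition Dom :: "('v, 'a) arena \<Rightarrow> nat set set \<Rightarrow> 'v ext set \<Rightarrow> 'v ext set" where
  "Dom \<A> \<K> L = {x \<in> ext_verts \<A> \<K>. \<exists>x'\<in>L. ext_le x x' \<and> x \<noteq> x'}"

definition max_elems :: "('v, 'a) arena \<Rightarrow> nat set set \<Rightarrow> 'v ext set \<Rightarrow> 'v ext set" where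
  "max_elems \<A> \<K> L = L - Dom \<A> \<K> L"

definition down :: "('v, 'a) arena \<Rightarrow> nat set set \<Rightarrow> 'v ext set \<Rightarrow> 'v ext set" where
  "down \<A> \<K> L = L \<union> Dom \<A> \<K> L"

definition max_union ::
    "('v, 'a) arena \<Rightarrow> nat set set \<Rightarrow> 'v ext set \<Rightarrow> 'v ext set \<Rightarrow> 'v ext set" where
  "max_union \<A> \<K> L L' = max_elems \<A> \<K> (L \<union> L')"


section \<open>Predecessor operators\<close>

definition KPred ::
    "('v, 'a) arena \<Rightarrow> nat set set \<Rightarrow> 'v \<Rightarrow> 'a \<Rightarrow> 'v ext set \<Rightarrow> nat set set" where
  "KPred \<A> \<K> v a S = {K \<in> \<K>. \<forall>v'\<in>verts \<A>. (v', K \<inter> nabla \<A> v a v') \<in> S}"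

definition Pred :: "('v, 'a) arena \<Rightarrow> nat set set \<Rightarrow> 'v ext set \<Rightarrow> 'v ext set" where
  "Pred \<A> \<K> S = (\<Union>v\<in>verts \<A>. \<Union>a\<in>enabled \<A> v. {(v, K) | K. K \<in> KPred \<A> \<K> v a S})"

definition KPredAlt ::
    "('v, 'a) arena \<Rightarrow> 'v \<Rightarrow> 'a \<Rightarrow> 'v ext set \<Rightarrow> nat set set" where
  "KPredAlt \<A> v a S =
     {\<Union>V'\<in>Pow (verts \<A>). nabla_set \<A> v a V' \<inter> Inter_pos (\<kappa> ` V') | \<kappa>.
        \<forall>v'\<in>verts \<A>. (v', \<kappa> v') \<in> S}"

definition PredAlt :: "('v, 'a) arena \<Rightarrow> 'v ext set \<Rightarrow> 'v ext set" where
  "PredAlt \<A> S = (\<Union>v\<in>verts \<A>. \<Union>a\<in>enabled \<A> v. {(v, K) | K. K \<in> KPredAlt \<A> v a S})"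


section \<open>The three sequences and their limits\<close>

definition W_init :: "('v, 'a) arena \<Rightarrow> 'v \<Rightarrow> 'v ext set" where
  "W_init \<A> t = {(t, posnat)} \<union> {(v, {}) | v. v \<in> verts \<A> - {t}}"

primrec W_coh :: "('v, 'a) arena \<Rightarrow> nat set set \<Rightarrow> 'v \<Rightarrow> nat \<Rightarrow> 'v ext set" where
  "W_coh \<A> \<K> t 0 = W_init \<A> t"
| "W_coh \<A> \<K> t (Suc i) =
     max_union \<A> \<K> (W_coh \<A> \<K> t i) (Pred \<A> \<K> (down \<A> \<K> (W_coh \<A> \<K> t i)))"

definition W_full :: "('v, 'a) arena \<Rightarrow> 'v \<Rightarrow> nat \<Rightarrow> 'v ext set" where
  "W_full \<A> t = W_coh \<A> (Pow posnat) t"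

(* No coherent set is attached to this sequence; domination is taken among all extended vertices. *)
primrec W_alt :: "('v, 'a) arena \<Rightarrow> 'v \<Rightarrow> nat \<Rightarrow> 'v ext set" where
  "W_alt \<A> t 0 = W_init \<A> t"
| "W_alt \<A> t (Suc i) =
     max_union \<A> (Pow posnat) (W_alt \<A> t i) (PredAlt \<A> (W_alt \<A> t i))"

definition eventually_constant :: "(nat \<Rightarrow> 'b) \<Rightarrow> bool" where
  "eventually_constant X \<longleftrightarrow> (\<exists>N. \<forall>i\<ge>N. X i = X N)"

definition eventual_value :: "(nat \<Rightarrow> 'b) \<Rightarrow> 'b" where
  "eventual_value X = (THE x. \<exists>N. \<forall>i\<ge>N. X i = x)"

end

theory Submission
  imports Defs
begin

text \<open>
  The set of \<open>KPredAlt\<close> built from a choice \<open>\<kappa>\<close> is the greatest \<open>K\<close> with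
  \<open>K \<inter> nabla \<A> v a v' \<subseteq> \<kappa> v'\<close> for all \<open>v'\<close>. Hence \<open>Pred\<close> of a downward closure is the downward
  closure of \<open>PredAlt\<close>, and both have the same maximal elements; this holds for every coherent set.
  The sets of parameters that do not separate parameters with equal transitions form a finite coherent
  set. Computed there, the downward closures form an increasing chain in a finite set,
  so they stabilize, and each member of the sequence is recovered from its downward closure.
\<close>

section \<open>Maximal elements and downward closures of extended vertices\<close>

lemma ext_le_refl: "ext_le x x"
  by (simp add: ext_le_def)

lemma ext_le_trans: "ext_le x y \<Longrightarrow> ext_le y z \<Longrightarrow> ext_le x z"
  by (auto simp: ext_le_def)

lemma ext_le_antisym: "ext_le x y \<Longrightarrow> ext_le y x \<Longrightarrow> x = y"
  by (auto simp: ext_le_def prod_eq_iff)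

lemma in_max_elems_iff:
  assumes "L \<subseteq> ext_verts \<A> \<K>"
  shows "x \<in> max_elems \<A> \<K> L \<longleftrightarrow> x \<in> L \<and> (\<forall>y\<in>L. ext_le x y \<longrightarrow> x = y)"
  using assms by (auto simp: max_elems_def Dom_def)

lemma in_down_iff:
  assumes "L \<subseteq> ext_verts \<A> \<K>"
  shows "x \<in> down \<A> \<K> L \<longleftrightarrow> x \<in> ext_verts \<A> \<K> \<and> (\<exists>y\<in>L. ext_le x y)"
  unfolding down_def Dom_def using assms ext_le_refl by blast

lemma down_subset:
  assumes "L \<subseteq> ext_verts \<A> \<K>"
  shows "down \<A> \<K> L \<subseteq> ext_verts \<A> \<K>"
  using assms by (auto simp: down_def Dom_def)

text \<open>An element of \<open>L\<close> outside \<open>L'\<close> lies strictly below one of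
  \<open>L'\<close>, so it is never maximal. This allows elements added by a downward closure to be
  discarded.\<close>

lemma max_elems_between:
  assumes "L' \<subseteq> L" "L \<subseteq> down \<A> \<K> L'" "L' \<subseteq> ext_verts \<A> \<K>"
  shows "max_elems \<A> \<K> L = max_elems \<A> \<K> L'"
proof -
  have L: "L \<subseteq> ext_verts \<A> \<K>"
    using assms down_subset by blast
  have ex: "\<exists>y\<in>L'. ext_le x y" if "x \<in> L" for x
    using that assms in_down_iff[OF assms(3)] by blast
  show ?thesis
  proof (intro set_eqI iffI)
    fix x assume "x \<in> max_elems \<A> \<K> L"
    then have x: "x \<in> L" "\<forall>y\<in>L. ext_le x y \<longrightarrow> x = y"
      using in_max_elems_iff[OF L] by auto
    then have "x \<in> L'"
      using ex[OF x(1)] assms(1) by auto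
    then show "x \<in> max_elems \<A> \<K> L'"
      using x assms(1) in_max_elems_iff[OF assms(3)] by auto
  next
    fix x assume "x \<in> max_elems \<A> \<K> L'"
    then have x: "x \<in> L'" "\<forall>y\<in>L'. ext_le x y \<longrightarrow> x = y"
      using in_max_elems_iff[OF assms(3)] by auto
    \<comment> \<open>Some \<open>z\<close> in \<open>L'\<close> lies above \<open>y\<close>;
      maximality in \<open>L'\<close> gives \<open>x = z\<close>, and antisymmetry squeezes
      \<open>y\<close> between them.\<close>
    have "x = y" if "y \<in> L" "ext_le x y" for y
      using ex[OF that(1)] that(2) x(2) ext_le_trans ext_le_antisym by metis
    then show "x \<in> max_elems \<A> \<K> L"
      using x(1) assms(1) in_max_elems_iff[OF L] by auto
  qed
qed

text \<open>\<open>Dom\<close> depends on the ambient coherent set, but only elements of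
  \<open>L\<close> get removed, and these lie in both ambient sets.\<close>

lemma max_elems_coherent_irrelevant:
  assumes "L \<subseteq> ext_verts \<A> \<K>" "L \<subseteq> ext_verts \<A> \<K>'"
  shows "max_elems \<A> \<K> L = max_elems \<A> \<K>' L"
  using in_max_elems_iff[OF assms(1)] in_max_elems_iff[OF assms(2)] by blast

lemma max_elems_idem:
  assumes "L \<subseteq> ext_verts \<A> \<K>"
  shows "max_elems \<A> \<K> (max_elems \<A> \<K> L) = max_elems \<A> \<K> L"
  using assms by (auto simp: max_elems_def Dom_def)

lemma max_elems_down:
  assumes "L \<subseteq> ext_verts \<A> \<K>"
  shows "max_elems \<A> \<K> (down \<A> \<K> L) = max_elems \<A> \<K> L"
  using max_elems_between[of L "down \<A> \<K> L"] assms by (auto simp: down_def)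

lemma ex_max_elem_above:
  assumes "L \<subseteq> ext_verts \<A> \<K>" "finite L" "x \<in> L"
  shows "\<exists>y\<in>max_elems \<A> \<K> L. ext_le x y"
  using assms(2,3)
proof (induction "card {y \<in> L. ext_le x y}" arbitrary: x rule: less_induct)
  case less
  show ?case
  proof (cases "x \<in> max_elems \<A> \<K> L")
    case True
    then show ?thesis using ext_le_refl by blast
  next
    case False
    then obtain y where y: "y \<in> L" "ext_le x y" "x \<noteq> y"
      using less.prems in_max_elems_iff[OF assms(1)] by blast
    \<comment> \<open>Moving up to \<open>y\<close> loses at least \<open>x\<close>, so the number
      of elements above decreases and the climb ends.\<close>
    have "{z \<in> L. ext_le y z} \<subset> {z \<in> L. ext_le x z}"
      using y less.prems(2) ext_le_refl[of x] ext_le_trans[OF y(2)] ext_le_antisym[OF y(2)] by blast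
    then have "card {z \<in> L. ext_le y z} < card {z \<in> L. ext_le x z}"
      using less.prems(1) by (intro psubset_card_mono) auto
    then show ?thesis
      using less.hyps[of y] less.prems(1) y ext_le_trans by blast
  qed
qed

section \<open>The two predecessor operators\<close>

text \<open>The sets \<open>nabla_set \<A> v a V'\<close> partition \<open>posnat\<close> by
  successor set, so \<open>k\<close> is tested only against \<open>V' = trans \<A> v a k\<close>: it
  must lie in \<open>\<kappa> v'\<close> for every successor \<open>v'\<close>.\<close>

lemma KPredAlt_eq:
  assumes "\<And>k. k \<in> posnat \<Longrightarrow> trans \<A> v a k \<subseteq> verts \<A>"
  shows "(\<Union>V'\<in>Pow (verts \<A>). nabla_set \<A> v a V' \<inter> Inter_pos (\<kappa> ` V')) =
         posnat - (\<Union>v'\<in>verts \<A>. nabla \<A> v a v' - \<kappa> v')" (is "?L = ?R")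
proof
  show "?L \<subseteq> ?R"
    by (auto simp: nabla_set_def Inter_pos_def)
  show "?R \<subseteq> ?L"
  proof
    fix k assume k: "k \<in> ?R"
    have "k \<in> nabla_set \<A> v a (trans \<A> v a k) \<inter> Inter_pos (\<kappa> ` trans \<A> v a k)"
      using k assms[of k] by (auto simp: nabla_set_def Inter_pos_def nabla_def)
    then show "k \<in> ?L"
      using k assms[of k] by blast
  qed
qed

lemma in_PredAlt_iff:
  assumes "parameterized_arena \<A>"
  shows "(v, K) \<in> PredAlt \<A> S \<longleftrightarrow>
    (\<exists>a\<in>enabled \<A> v. \<exists>\<kappa>. v \<in> verts \<A> \<and> (\<forall>v'\<in>verts \<A>. (v', \<kappa> v') \<in> S) \<and>
      K = posnat - (\<Union>v'\<in>verts \<A>. nabla \<A> v a v' - \<kappa> v'))"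
proof -
  have "K \<in> KPredAlt \<A> v a S \<longleftrightarrow> (\<exists>\<kappa>. (\<forall>v'\<in>verts \<A>. (v', \<kappa> v') \<in> S) \<and>
      K = posnat - (\<Union>v'\<in>verts \<A>. nabla \<A> v a v' - \<kappa> v'))"
    if "v \<in> verts \<A>" "a \<in> enabled \<A> v" for a
  proof -
    have "trans \<A> v a k \<subseteq> verts \<A>" if "k \<in> posnat" for k
      using that \<open>v \<in> verts \<A>\<close> \<open>a \<in> enabled \<A> v\<close> assms
      by (simp add: parameterized_arena_def enabled_def)
    from KPredAlt_eq[OF this] show ?thesis
      by (auto simp: KPredAlt_def)
  qed
  then show ?thesis
    by (auto simp: PredAlt_def)
qed

lemma coherent_Union:
  assumes "coherent \<A> \<K>" "finite I" "\<And>i. i \<in> I \<Longrightarrow> F i \<in> \<K>"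
  shows "(\<Union>i\<in>I. F i) \<in> \<K>"
  using assms(2,3) by (induction I) (use assms(1) in \<open>auto simp: coherent_def\<close>)

text \<open>The closed form uses only differences and a union over the finite set of vertices, under
  which a coherent set is closed. So \<open>PredAlt\<close> never leaves any coherent set containing
  its inputs.\<close>

lemma PredAlt_subset:
  assumes "parameterized_arena \<A>" "coherent \<A> \<K>" "S \<subseteq> ext_verts \<A> \<K>"
  shows "PredAlt \<A> S \<subseteq> ext_verts \<A> \<K>"
proof
  fix x assume "x \<in> PredAlt \<A> S"
  then obtain v K where x: "x = (v, K)" "(v, K) \<in> PredAlt \<A> S"
    by (cases x) auto
  then obtain a \<kappa> where h: "a \<in> enabled \<A> v" "v \<in> verts \<A>" "\<forall>v'\<in>verts \<A>. (v', \<kappa> v') \<in> S"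
    and K: "K = posnat - (\<Union>v'\<in>verts \<A>. nabla \<A> v a v' - \<kappa> v')"
    unfolding in_PredAlt_iff[OF assms(1)] by blast
  have "(\<Union>v'\<in>verts \<A>. nabla \<A> v a v' - \<kappa> v') \<in> \<K>"
  proof (rule coherent_Union[OF assms(2)])
    show "finite (verts \<A>)"
      using assms(1) by (simp add: parameterized_arena_def)
    show "nabla \<A> v a v' - \<kappa> v' \<in> \<K>" if "v' \<in> verts \<A>" for v'
    proof -
      have "\<kappa> v' \<in> \<K>"
        using that h(3) assms(3) by (auto simp: ext_verts_def)
      then show ?thesis
        using that h(1,2) assms(2) by (simp add: coherent_def enabled_def)
    qed
  qed
  then have "K \<in> \<K>"
    using assms(2) K by (simp add: coherent_def)
  then show "x \<in> ext_verts \<A> \<K>"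
    using x(1) h(2) by (simp add: ext_verts_def)
qed

lemma Pred_down_eq:
  assumes "parameterized_arena \<A>" "coherent \<A> \<K>" "S \<subseteq> ext_verts \<A> \<K>"
  shows "Pred \<A> \<K> (down \<A> \<K> S) = down \<A> \<K> (PredAlt \<A> S)"
proof -
  have "(v, K) \<in> Pred \<A> \<K> (down \<A> \<K> S) \<longleftrightarrow> (v, K) \<in> down \<A> \<K> (PredAlt \<A> S)" for v K
  proof
    assume "(v, K) \<in> Pred \<A> \<K> (down \<A> \<K> S)"
    then obtain a where a: "v \<in> verts \<A>" "a \<in> enabled \<A> v" "K \<in> \<K>"
      "\<forall>v'\<in>verts \<A>. (v', K \<inter> nabla \<A> v a v') \<in> down \<A> \<K> S"
      by (auto simp: Pred_def KPred_def)
    then have "\<forall>v'\<in>verts \<A>. \<exists>K'. (v', K') \<in> S \<and> K \<inter> nabla \<A> v a v' \<subseteq> K'"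
      unfolding in_down_iff[OF assms(3)] ext_le_def by fastforce
    then obtain \<kappa> where \<kappa>: "\<forall>v'\<in>verts \<A>. (v', \<kappa> v') \<in> S \<and> K \<inter> nabla \<A> v a v' \<subseteq> \<kappa> v'"
      by metis
    \<comment> \<open>A parameter is missing from \<open>M\<close> only if it leads to some
      \<open>v'\<close> without lying in \<open>\<kappa> v'\<close>; the choice of
      \<open>\<kappa>\<close> excludes this for members of \<open>K\<close>.\<close>
    define M where "M = posnat - (\<Union>v'\<in>verts \<A>. nabla \<A> v a v' - \<kappa> v')"
    have "(v, M) \<in> PredAlt \<A> S"
      unfolding in_PredAlt_iff[OF assms(1)] using a(1,2) \<kappa> M_def by blast
    moreover have "K \<subseteq> M"
      using \<kappa> a(3) assms(2) unfolding M_def coherent_def by blast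
    ultimately show "(v, K) \<in> down \<A> \<K> (PredAlt \<A> S)"
      unfolding in_down_iff[OF PredAlt_subset[OF assms]] using a(1,3)
      by (auto simp: ext_le_def ext_verts_def intro!: bexI[of _ "(v, M)"])
  next
    assume "(v, K) \<in> down \<A> \<K> (PredAlt \<A> S)"
    then obtain M where M: "K \<in> \<K>" "v \<in> verts \<A>" "(v, M) \<in> PredAlt \<A> S" "K \<subseteq> M"
      unfolding in_down_iff[OF PredAlt_subset[OF assms]] by (auto simp: ext_le_def ext_verts_def)
    then obtain a \<kappa> where h: "a \<in> enabled \<A> v" "\<forall>v'\<in>verts \<A>. (v', \<kappa> v') \<in> S"
      "M = posnat - (\<Union>v'\<in>verts \<A>. nabla \<A> v a v' - \<kappa> v')"
      unfolding in_PredAlt_iff[OF assms(1)] by blast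
    have "(v', K \<inter> nabla \<A> v a v') \<in> down \<A> \<K> S" if v': "v' \<in> verts \<A>" for v'
    proof -
      have "K \<inter> nabla \<A> v a v' \<in> \<K>"
        using M(1,2) h(1) v' assms(2) by (simp add: coherent_def enabled_def)
      moreover have "K \<inter> nabla \<A> v a v' \<subseteq> \<kappa> v'"
        using M(4) h(3) v' by blast
      ultimately show ?thesis
        unfolding in_down_iff[OF assms(3)] using v' h(2)
        by (auto simp: ext_le_def ext_verts_def intro!: bexI[of _ "(v', \<kappa> v')"])
    qed
    then show "(v, K) \<in> Pred \<A> \<K> (down \<A> \<K> S)"
      using M(1,2) h(1) by (auto simp: Pred_def KPred_def)
  qed
  then show ?thesis
    by auto
qed

section \<open>Equality of the sequences\<close>

lemma W_init_subset:
  assumes "t \<in> verts \<A>" "coherent \<A> \<K>"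
  shows "W_init \<A> t \<subseteq> ext_verts \<A> \<K>"
  using assms by (auto simp: W_init_def ext_verts_def coherent_def)

lemma W_alt_subset:
  assumes "parameterized_arena \<A>" "coherent \<A> \<K>" "t \<in> verts \<A>"
  shows "W_alt \<A> t i \<subseteq> ext_verts \<A> \<K>"
proof (induction i)
  case 0
  show ?case using W_init_subset assms by simp
next
  case (Suc i)
  then show ?case
    using PredAlt_subset[OF assms(1,2)] by (auto simp: max_union_def max_elems_def)
qed

text \<open>The recursion takes domination in \<open>Pow posnat\<close>; since its values lie in
  every coherent set, domination may be taken in whichever one is convenient.\<close>

lemma W_alt_Suc:
  assumes "parameterized_arena \<A>" "coherent \<A> \<K>" "t \<in> verts \<A>"
  shows "W_alt \<A> t (Suc i) = max_elems \<A> \<K> (W_alt \<A> t i \<union> PredAlt \<A> (W_alt \<A> t i))"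
proof -
  have "W_alt \<A> t i \<union> PredAlt \<A> (W_alt \<A> t i) \<subseteq> ext_verts \<A> \<K>'" if "coherent \<A> \<K>'" for \<K>'
    using W_alt_subset[OF assms(1) that assms(3)]
      PredAlt_subset[OF assms(1) that W_alt_subset[OF assms(1) that assms(3)]] by blast
  from max_elems_coherent_irrelevant[OF this[OF coherent_Pow] this[OF assms(2)]]
  show ?thesis
    by (simp add: max_union_def)
qed

lemma W_coh_eq_W_alt:
  assumes "parameterized_arena \<A>" "coherent \<A> \<K>" "t \<in> verts \<A>"
  shows "W_coh \<A> \<K> t i = W_alt \<A> t i"
proof (induction i)
  case 0
  show ?case by simp
next
  case (Suc i)
  let ?W = "W_alt \<A> t i"
  have W: "?W \<subseteq> ext_verts \<A> \<K>" "PredAlt \<A> ?W \<subseteq> ext_verts \<A> \<K>"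
    using W_alt_subset[OF assms] PredAlt_subset[OF assms(1,2)] by auto
  have "W_coh \<A> \<K> t (Suc i) = max_elems \<A> \<K> (?W \<union> down \<A> \<K> (PredAlt \<A> ?W))"
    using Suc Pred_down_eq[OF assms(1,2) W(1)] by (simp add: max_union_def)
  \<comment> \<open>The closure adds only elements strictly below members of
    \<open>PredAlt\<close>.\<close>
  also have "\<dots> = max_elems \<A> \<K> (?W \<union> PredAlt \<A> ?W)"
    by (rule max_elems_between) (use W in \<open>auto simp: down_def Dom_def\<close>)
  also have "\<dots> = W_alt \<A> t (Suc i)"
    using W_alt_Suc[OF assms] by simp
  finally show ?case .
qed

section \<open>A finite coherent set\<close>

definition transition_signature :: "('v, 'a) arena \<Rightarrow> nat \<Rightarrow> ('v \<times> 'a \<times> 'v) set" where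
  "transition_signature \<A> k = {(v, a, v') \<in> verts \<A> \<times> acts \<A> \<times> verts \<A>. v' \<in> trans \<A> v a k}"

text \<open>These are the unions of classes of parameters with equal signature. As preimages they
  inherit Boolean closure from the families \<open>P\<close>, and finiteness from there being
  finitely many such families.\<close>

definition saturated_sets :: "('v, 'a) arena \<Rightarrow> nat set set" where
  "saturated_sets \<A> = {posnat \<inter> transition_signature \<A> -` P | P. P \<subseteq> Pow (verts \<A> \<times> acts \<A> \<times> verts \<A>)}"

lemma transition_signature_subset:
  "transition_signature \<A> k \<in> Pow (verts \<A> \<times> acts \<A> \<times> verts \<A>)"
  by (auto simp: transition_signature_def)

lemma finite_saturated_sets:
  assumes "parameterized_arena \<A>"
  shows "finite (saturated_sets \<A>)"
proof -
  have "saturated_sets \<A> = (\<lambda>P. posnat \<inter> transition_signature \<A> -` P) `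
      Pow (Pow (verts \<A> \<times> acts \<A> \<times> verts \<A>))"
    by (auto simp: saturated_sets_def)
  then show ?thesis
    using assms by (simp add: parameterized_arena_def)
qed

lemma coherent_saturated_sets: "coherent \<A> (saturated_sets \<A>)"
proof -
  let ?U = "Pow (verts \<A> \<times> acts \<A> \<times> verts \<A>)"
  let ?f = "\<lambda>P. posnat \<inter> transition_signature \<A> -` P"
  have memI: "K \<in> saturated_sets \<A>" if "K = ?f P" "P \<subseteq> ?U" for K P
    using that by (auto simp: saturated_sets_def)
  have closed: "K \<union> K' \<in> saturated_sets \<A> \<and> K \<inter> K' \<in> saturated_sets \<A> \<and> K - K' \<in> saturated_sets \<A>"
    if K: "K \<in> saturated_sets \<A>" "K' \<in> saturated_sets \<A>" for K K'
  proof -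
    obtain P P' where "K = ?f P" "P \<subseteq> ?U" "K' = ?f P'" "P' \<subseteq> ?U"
      using K by (auto simp: saturated_sets_def)
    then have "K \<union> K' = ?f (P \<union> P')" "P \<union> P' \<subseteq> ?U" "K \<inter> K' = ?f (P \<inter> P')" "P \<inter> P' \<subseteq> ?U"
      "K - K' = ?f (P - P')" "P - P' \<subseteq> ?U"
      by blast+
    then show ?thesis
      using memI by metis
  qed
  have nabla: "nabla \<A> v a v' \<in> saturated_sets \<A>"
    if "v \<in> verts \<A>" "a \<in> acts \<A>" "v' \<in> verts \<A>" for v a v'
    \<comment> \<open>Membership of \<open>k\<close> in this \<open>nabla\<close> can be read off
      from its signature.\<close>
    by (rule memI[where P = "{s \<in> ?U. (v, a, v') \<in> s}"])
      (use that in \<open>auto simp: nabla_def transition_signature_def\<close>)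
  have "posnat \<in> saturated_sets \<A>"
    by (rule memI[where P = ?U]) (use transition_signature_subset in blast)+
  moreover have "{} \<in> saturated_sets \<A>"
    by (rule memI[where P = "{}"]) auto
  moreover have "saturated_sets \<A> \<subseteq> Pow posnat"
    by (auto simp: saturated_sets_def)
  ultimately show ?thesis
    using closed nabla unfolding coherent_def by blast
qed

section \<open>Stabilization\<close>

text \<open>The cardinalities are bounded, so some \<open>D N\<close> has the largest one; every
  later set contains \<open>D N\<close> and is no larger.\<close>

lemma eventually_constant_if_incseq_finite:
  fixes D :: "nat \<Rightarrow> 'b set"
  assumes "mono D" "finite F" "\<And>i. D i \<subseteq> F"
  shows "eventually_constant D"
proof -
  have "\<forall>i. card (D i) < Suc (card F)"
    using card_mono[OF assms(2,3)] by (simp add: less_Suc_eq_le)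
  then obtain N where N: "\<forall>i. card (D i) \<le> card (D N)"
    using ex_has_greatest_nat[of "\<lambda>_. True" 0 "\<lambda>i. card (D i)" "Suc (card F)"] by auto
  have "D i = D N" if "i \<ge> N" for i
    using card_seteq[OF finite_subset[OF assms(3,2)] monoD[OF assms(1) that]] N by simp
  then show ?thesis
    by (auto simp: eventually_constant_def)
qed

text \<open>\<open>W_init\<close> has one element per vertex, hence no comparable pair; later
  members are themselves sets of maximal elements.\<close>

lemma max_elems_W_alt:
  assumes "parameterized_arena \<A>" "coherent \<A> \<K>" "t \<in> verts \<A>"
  shows "max_elems \<A> \<K> (W_alt \<A> t i) = W_alt \<A> t i"
proof (cases i)
  case 0
  show ?thesis
    unfolding 0 by (auto simp: max_elems_def Dom_def W_init_def ext_le_def)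
next
  case (Suc j)
  have "W_alt \<A> t j \<union> PredAlt \<A> (W_alt \<A> t j) \<subseteq> ext_verts \<A> \<K>"
    using W_alt_subset[OF assms] PredAlt_subset[OF assms(1,2)] by auto
  then show ?thesis
    unfolding Suc W_alt_Suc[OF assms] by (rule max_elems_idem)
qed

text \<open>\<open>W_alt\<close> need not increase, since an element may be replaced by a larger
  one; its downward closures do increase, and among saturated sets they have finite room.\<close>

lemma eventually_constant_W_alt:
  assumes "parameterized_arena \<A>" "t \<in> verts \<A>"
  shows "eventually_constant (W_alt \<A> t)"
proof -
  let ?K = "saturated_sets \<A>"
  let ?W = "W_alt \<A> t"
  let ?D = "\<lambda>i. down \<A> ?K (?W i)"
  note coh = coherent_saturated_sets[of \<A>]
  have fin: "finite (ext_verts \<A> ?K)"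
    using assms(1) finite_saturated_sets[OF assms(1)]
    by (simp add: ext_verts_def parameterized_arena_def)
  have W: "?W i \<subseteq> ext_verts \<A> ?K" for i
    using W_alt_subset[OF assms(1) coh assms(2)] .
  have "?D i \<subseteq> ?D (Suc i)" for i
  proof
    fix x assume "x \<in> ?D i"
    then obtain y where y: "x \<in> ext_verts \<A> ?K" "y \<in> ?W i" "ext_le x y"
      using in_down_iff[OF W] by blast
    have sub: "?W i \<union> PredAlt \<A> (?W i) \<subseteq> ext_verts \<A> ?K"
      using W PredAlt_subset[OF assms(1) coh W] by blast
    \<comment> \<open>Even if \<open>y\<close> is dropped, finiteness provides a surviving maximal
      element above it.\<close>
    have "\<exists>z\<in>?W (Suc i). ext_le y z"
      unfolding W_alt_Suc[OF assms(1) coh assms(2)]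
      by (rule ex_max_elem_above[OF sub finite_subset[OF sub fin]]) (use y(2) in blast)
    then show "x \<in> ?D (Suc i)"
      using in_down_iff[OF W] y ext_le_trans by blast
  qed
  then have "mono ?D"
    by (simp add: mono_iff_le_Suc)
  then have "eventually_constant ?D"
    using fin down_subset[OF W] by (rule eventually_constant_if_incseq_finite)
  moreover have "?W i = max_elems \<A> ?K (?D i)" for i
    using max_elems_down[OF W] max_elems_W_alt[OF assms(1) coh assms(2)] by simp
  ultimately show ?thesis
    unfolding eventually_constant_def by metis
qed

theorem theorem21:
  fixes \<A> :: "('v, 'a) arena" and t :: 'v and \<K> :: "nat set set"
  assumes "parameterized_arena \<A>"
    and "complete_for_enabled \<A>"
    and "t \<in> verts \<A>"
    and "coherent \<A> \<K>"
  shows "(\<forall>i. W_full \<A> t i = W_alt \<A> t i \<and> W_alt \<A> t i = W_coh \<A> \<K> t i) \<and>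
         eventually_constant (W_full \<A> t) \<and>
         eventually_constant (W_alt \<A> t) \<and>
         eventually_constant (W_coh \<A> \<K> t) \<and>
         eventual_value (W_full \<A> t) = eventual_value (W_alt \<A> t) \<and>
         eventual_value (W_alt \<A> t) = eventual_value (W_coh \<A> \<K> t)"
proof -
  have "W_coh \<A> \<K> t = W_alt \<A> t"
    using W_coh_eq_W_alt[OF assms(1,4,3)] by blast
  moreover have "W_full \<A> t = W_alt \<A> t"
    using W_coh_eq_W_alt[OF assms(1) coherent_Pow assms(3)] unfolding W_full_def by blast
  \<comment> \<open>The sequences agree as functions, so their limits agree by rewriting.\<close>
  ultimately show ?thesis
    using eventually_constant_W_alt[OF assms(1,3)] by simp
qed

end
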